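(* Let $n,m\in\mathbb N_0$ with $n\ge m$, let $\lambda\in\mathbb C$ with $2\lambda+1\notin\{0,-1,-2,\ldots\}$, and let $x\in(-1,1)$. Then $${\sf P}_{n+\lambda}^{-\lambda}(x)\,{\sf P}_{m+\lambda}^{-\lambda}(x)=\frac{2^{\lambda}\,\Gamma(\lambda+\frac12)\,m!\,n!\,(1-x^2)^{\frac{\lambda}{2}}}{\sqrt{\pi}\,\Gamma(2\lambda+m+1)\,\Gamma(2\lambda+n+1)}\sum_{k=0}^{m}B^{\lambda+\frac12}_{k,m,n}\,\frac{\Gamma(2\lambda+n+m-2k+1)}{(n+m-2k)!}\,{\sf P}_{n+m-2k+\lambda}^{-\lambda}(x),$$ where $$B^{\rho}_{k,m,n}=\frac{(m+n+\rho-2k)\,(m+n-2k)!\,(\rho)_k(\rho)_{m-k}(\rho)_{n-k}(2\rho)_{m+n-k}}{(m+n+\rho-k)\,k!\,(m-k)!\,(n-k)!\,(\rho)_{m+n-k}(2\rho)_{m+n-2k}}.$$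
   Context: $\mathbb N_0=\{0,1,2,\ldots\}$; $(a)_0=1$, $(a)_k=a(a+1)\cdots(a+k-1)$. The Ferrers function of the first kind is, for $\nu,\mu\in\mathbb C$ and $x\in(-1,1)$, $${\sf P}_\nu^{-\mu}(x)=\frac{1}{\Gamma(\mu+1)}\left(\frac{1-x}{1+x}\right)^{\frac{\mu}{2}}{}_2F_1\left(-\nu,\nu+1;\mu+1;\frac{1-x}{2}\right)=\left(\frac{1-x}{1+x}\right)^{\frac{\mu}{2}}\sum_{j=0}^\infty\frac{(-\nu)_j(\nu+1)_j}{\Gamma(\mu+1+j)\,j!}\left(\frac{1-x}{2}\right)^j,$$ where $1/\Gamma$ is the entire reciprocal gamma function. Powers of positive reals are principal. *)

theory Defs
  imports "HOL-Analysis.Analysis"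
begin

text \<open>
  Ferrers function of the first kind \<open>P\<^sub>\<nu>\<^sup>\<mu>(x)\<close>, \<open>-1 < x < 1\<close>, written with the entire reciprocal
  Gamma function so that it is defined for all complex degrees and orders. The source formula is
  for order \<open>-\<mu>\<close>; here \<open>\<mu>\<close> is the order itself (see \<open>Ferrers_P_neg_order\<close> below).
\<close>

definition Ferrers_P :: "complex \<Rightarrow> complex \<Rightarrow> real \<Rightarrow> complex" where
  "Ferrers_P \<nu> \<mu> x =
     complex_of_real ((1 - x) / (1 + x)) powr (- \<mu> / 2) *
     (\<Sum>j. pochhammer (- \<nu>) j * pochhammer (\<nu> + 1) j * rGamma (1 - \<mu> + of_nat j) / fact j *
           complex_of_real ((1 - x) / 2) ^ j)"

lemma Ferrers_P_neg_order:
  "Ferrers_P \<nu> (- \<mu>) x =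
     complex_of_real ((1 - x) / (1 + x)) powr (\<mu> / 2) *
     (\<Sum>j. pochhammer (- \<nu>) j * pochhammer (\<nu> + 1) j / (fact j) * rGamma (\<mu> + 1 + of_nat j) *
           complex_of_real ((1 - x) / 2) ^ j)"
  by (simp add: Ferrers_P_def add.commute)

text \<open>
  Coefficients of Dougall's linearization formula for products of Gegenbauer polynomials,
  meaningful for \<open>k \<le> min m n\<close>, where the natural-number subtractions do not truncate.
\<close>

definition gegenbauer_lin_coeff :: "complex \<Rightarrow> nat \<Rightarrow> nat \<Rightarrow> nat \<Rightarrow> complex" where
  "gegenbauer_lin_coeff \<rho> k m n =
     ((of_nat m + of_nat n + \<rho> - 2 * of_nat k) * fact (m + n - 2 * k) *
       pochhammer \<rho> k * pochhammer \<rho> (m - k) * pochhammer \<rho> (n - k) *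
       pochhammer (2 * \<rho>) (m + n - k)) /
     ((of_nat m + of_nat n + \<rho> - of_nat k) * fact k * fact (m - k) * fact (n - k) *
       pochhammer \<rho> (m + n - k) * pochhammer (2 * \<rho>) (m + n - 2 * k))"

end

theory Submission
  imports Defs
begin

text \<open>
  For fixed \<open>\<lambda>\<close> and \<open>x\<close> put \<open>p\<^sub>n = P\<^bsub>n+\<lambda>\<^esub>\<^sup>-\<^sup>\<lambda>(x)\<close> and \<open>r = \<lambda> + 1/2\<close>. The contiguous relation for the
  hypergeometric coefficients (\<open>ferrers_coeff_recurrence\<close>) shows that \<open>p\<close> satisfies the three-term
  recurrence of the normalized ultraspherical polynomials of parameter \<open>r\<close>,
  \<open>(n + 2r) p\<^bsub>n+1\<^esub> = 2(n + r) x p\<^sub>n - n p\<^bsub>n-1\<^esub>\<close> (\<open>Ferrers_P_recurrence\<close>). At \<open>n = 0\<close> the last term drops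
  out, so \<open>p\<^sub>n\<close> is \<open>p\<^sub>0\<close> times an ultraspherical polynomial, and a product \<open>p\<^sub>m p\<^sub>n\<close> is \<open>p\<^sub>0\<close> times a
  linear combination of terms \<open>p\<^sub>j\<close> given by Dougall's linearization formula.

  Dougall's formula itself follows from the recurrence alone (\<open>ultraspherical_linearization\<close>), by
  induction on \<open>m\<close>: the recurrence in \<open>m\<close> expresses \<open>p\<^bsub>m+1\<^esub> p\<^sub>n\<close> through \<open>x p\<^sub>m p\<^sub>n\<close> and \<open>p\<^bsub>m-1\<^esub> p\<^sub>n\<close>, and
  the same recurrence in the degree of the expanded terms absorbs the factor \<open>x\<close>. What remains is
  a recurrence for the coefficients. Dividing it by common Pochhammer factors leaves one identity
  of rational functions (\<open>weight_rational_identity\<close>).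

  The constant is \<open>p\<^sub>0\<close>, which the binomial series evaluates in closed form
  (\<open>Ferrers_P_neg_self\<close>); Legendre's duplication formula brings it to the stated shape
  (\<open>Gamma_normalization\<close>).
\<close>

section \<open>Linearization from the ultraspherical recurrence\<close>

text \<open>
  Dougall's coefficient of degree \<open>N = m + n - 2k\<close> without the factor \<open>(N + r) N! / (2r)\<^sub>N\<close>. It is
  used for \<open>k \<le> m \<le> n\<close>, where the natural-number subtractions do not truncate. The denominator
  \<open>(r)\<^bsub>m+n-k+1\<^esub>\<close> combines \<open>(r)\<^bsub>m+n-k\<^esub>\<close> with the linear factor \<open>m + n + r - k\<close>.
\<close>

definition linearization_weight :: "'a::field_char_0 \<Rightarrow> nat \<Rightarrow> nat \<Rightarrow> nat \<Rightarrow> 'a" where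
  "linearization_weight r k m n =
     (pochhammer r k / fact k) * (pochhammer r (m - k) / fact (m - k)) *
     (pochhammer r (n - k) / fact (n - k)) *
     (pochhammer (2 * r) (m + n - k) / pochhammer r (Suc (m + n - k)))"

lemma add_of_nat_neq_0:
  fixes z :: "'a::ring_1"
  assumes "z \<notin> \<int>\<^sub>\<le>\<^sub>0"
  shows "z + of_nat j \<noteq> 0"
  using assms by (metis add.commute minus_of_nat_in_nonpos_Ints add_eq_0_iff2)

lemma half_notin_nonpos_Ints:
  fixes r :: "'a::field_char_0"
  assumes "2 * r \<notin> \<int>\<^sub>\<le>\<^sub>0"
  shows "r \<notin> \<int>\<^sub>\<le>\<^sub>0"
proof
  assume "r \<in> \<int>\<^sub>\<le>\<^sub>0"
  then obtain j where "r = - of_nat j" by (rule nonpos_Ints_cases')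
  then have "2 * r = - of_nat (2 * j)" by simp
  then show False using assms by (metis minus_of_nat_in_nonpos_Ints)
qed

lemma pochhammer_over_fact_Suc:
  fixes r :: "'a::field_char_0"
  shows "pochhammer r (Suc j) / fact (Suc j) =
     (pochhammer r j / fact j) * ((r + of_nat j) / (of_nat j + 1))"
  by (simp add: pochhammer_Suc field_simps)

lemma pochhammer_quotient_Suc:
  fixes r :: "'a::field_char_0"
  shows "pochhammer (2 * r) (Suc s) / pochhammer r (Suc (Suc s)) =
     (pochhammer (2 * r) s / pochhammer r (Suc s)) *
       ((2 * r + of_nat s) / (r + of_nat s + 1))"
  by (simp add: pochhammer_Suc[of _ s] pochhammer_Suc[of r "Suc s"] add_ac)

text \<open>
  The coefficient recurrence divided by
  \<open>(r)\<^sub>i/i! * (r)\<^sub>p/p! * (r)\<^sub>q/q! * (2r)\<^sub>s/(r)\<^bsub>s+1\<^esub>\<close>, where \<open>p = m - k\<close>, \<open>q = n - k\<close>, \<open>i = k - 1\<close>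
  and \<open>s = m + n - k = p + q + i + 1\<close>.
\<close>

lemma weight_rational_identity:
  fixes r i p q :: "'a::field_char_0"
  assumes "i + 1 \<noteq> 0" "p + 1 \<noteq> 0" "q + 1 \<noteq> 0" "r + (p + q + i + 1) + 1 \<noteq> 0"
  shows "(p + i + 2) * (((r + i) / (i + 1)) * ((r + p) / (p + 1)) *
           ((2 * r + (p + q + i + 1)) / (r + (p + q + i + 1) + 1))) * (p + q + 1 + r) =
    (p + i + 1 + r) * (((r + i) / (i + 1)) * (p + q + 2 * r) +
       ((r + p) / (p + 1)) * ((r + q) / (q + 1)) *
         ((2 * r + (p + q + i + 1)) / (r + (p + q + i + 1) + 1)) * (p + q + 2)) -
    (p + i + 2 * r) * ((r + q) / (q + 1)) * (p + q + 1 + r)"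
proof -
  define I P Q S where "I = i + 1" and "P = p + 1" and "Q = q + 1"
    and "S = r + (p + q + i + 1) + 1"
  have nz: "I \<noteq> 0" "P \<noteq> 0" "Q \<noteq> 0" "S \<noteq> 0"
    using assms by (simp_all add: I_def P_def Q_def S_def)
  have *: "(p + i + 2) * (r + i) * (r + p) * (2 * r + (p + q + i + 1)) * (p + q + 1 + r) * Q =
     (p + i + 1 + r) * ((r + i) * (p + q + 2 * r) * P * Q * S
       + (r + p) * (r + q) * (2 * r + (p + q + i + 1)) * (p + q + 2) * I)
     - (p + i + 2 * r) * (r + q) * (p + q + 1 + r) * I * P * S"
    unfolding I_def P_def Q_def S_def by algebra
  show ?thesis
    unfolding I_def[symmetric] P_def[symmetric] Q_def[symmetric] S_def[symmetric]
    using nz * by (simp add: divide_simps) algebra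
qed

text \<open>
  The next three lemmas compare the coefficients of the term of degree \<open>m + n + 1 - 2k\<close> in the
  expansions of \<open>p\<^bsub>m+1\<^esub> p\<^sub>n\<close>, \<open>x p\<^sub>m p\<^sub>n\<close> and \<open>p\<^bsub>m-1\<^esub> p\<^sub>n\<close>, for \<open>1 \<le> k \<le> m\<close> (written \<open>Suc k\<close> with
  \<open>k < m\<close>), \<open>k = 0\<close> and \<open>k = m + 1\<close>. In the two extreme cases fewer terms contribute.
\<close>

lemma weight_recurrence_interior:
  fixes r :: "'a::field_char_0"
  assumes "r \<notin> \<int>\<^sub>\<le>\<^sub>0" and "k < m" and "m < n"
  shows "(of_nat m + 1) * linearization_weight r (Suc k) (Suc m) n * (of_nat (m + n - Suc (2 * k)) + r) =
    (of_nat m + r) * (linearization_weight r (Suc k) m n * (of_nat (m + n - 2 * Suc k) + 2 * r) +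
       linearization_weight r k m n * of_nat (m + n - 2 * k)) -
    (of_nat m + 2 * r - 1) * linearization_weight r k (m - 1) n * (of_nat (m + n - Suc (2 * k)) + r)"
proof -
  obtain p where m: "m = Suc (p + k)" using assms(2) by (metis add.commute less_imp_Suc_add)
  obtain q where n: "n = Suc (q + k)"
    using assms(2,3) by (metis add.commute less_imp_Suc_add less_trans)
  define s where "s = Suc (p + q + k)"
  define a where "a = (\<lambda>j. pochhammer r j / fact j)"
  define b where "b = (\<lambda>j. pochhammer (2 * r) j / pochhammer r (Suc j))"
  have aS: "a (Suc j) = a j * ((r + of_nat j) / (of_nat j + 1))" for j
    unfolding a_def by (rule pochhammer_over_fact_Suc)
  have bS: "b (Suc j) = b j * ((2 * r + of_nat j) / (r + of_nat j + 1))" for j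
    unfolding b_def by (rule pochhammer_quotient_Suc)
  have W: "linearization_weight r k' m' n' = a k' * a (m' - k') * a (n' - k') * b (m' + n' - k')"
    for k' m' n' by (simp add: linearization_weight_def a_def b_def)
  have w1: "linearization_weight r (Suc k) (Suc m) n = a (Suc k) * a (Suc p) * a q * b (Suc s)"
    by (simp add: W m n s_def add_ac)
  have w2: "linearization_weight r (Suc k) m n = a (Suc k) * a p * a q * b s"
    by (simp add: W m n s_def add_ac)
  have w3: "linearization_weight r k m n = a k * a (Suc p) * a (Suc q) * b (Suc s)"
    by (simp add: W m n s_def add_ac Suc_diff_le)
  have w4: "linearization_weight r k (m - 1) n = a k * a p * a (Suc q) * b s"
    by (simp add: W m n s_def add_ac Suc_diff_le)
  have N: "m + n - Suc (2 * k) = Suc (p + q)" "m + n - 2 * Suc k = p + q" "m + n - 2 * k = Suc (Suc (p + q))"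
    by (simp_all add: m n)
  define i' p' q' :: 'a where "i' = of_nat k" and "p' = of_nat p" and "q' = of_nat q"
  have s': "of_nat s = p' + q' + i' + 1" by (simp add: s_def i'_def p'_def q'_def)
  have nz: "i' + 1 \<noteq> 0" "p' + 1 \<noteq> 0" "q' + 1 \<noteq> 0"
    unfolding i'_def p'_def q'_def by (metis of_nat_Suc of_nat_neq_0 add.commute)+
  have nzs: "r + (p' + q' + i' + 1) + 1 \<noteq> 0"
    using add_of_nat_neq_0[OF assms(1), of "Suc s"] s' by (simp add: add_ac)
  note id = weight_rational_identity[OF nz nzs]
  define c where "c = a k * a p * a q * b s"
  define x1 where "x1 = (r + i') / (i' + 1)"
  define x2 where "x2 = (r + p') / (p' + 1)"
  define x3 where "x3 = (r + q') / (q' + 1)"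
  define x4 where "x4 = (2 * r + (p' + q' + i' + 1)) / (r + (p' + q' + i' + 1) + 1)"
  have v: "linearization_weight r (Suc k) (Suc m) n = c * (x1 * x2 * x4)"
    "linearization_weight r (Suc k) m n = c * x1"
    "linearization_weight r k m n = c * (x2 * x3 * x4)"
    "linearization_weight r k (m - 1) n = c * x3"
    unfolding w1 w2 w3 w4 aS bS s' c_def x1_def x2_def x3_def x4_def i'_def p'_def q'_def
    by (simp_all only: mult_ac)
  have m': "(of_nat m :: 'a) = p' + i' + 1" by (simp add: m p'_def i'_def)
  have N': "(of_nat (p + q) :: 'a) = p' + q'" "(of_nat (Suc (p + q)) :: 'a) = p' + q' + 1"
    "(of_nat (Suc (Suc (p + q))) :: 'a) = p' + q' + 2"
    by (simp_all add: p'_def q'_def)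
  from id show ?thesis
    unfolding v N N' m' x1_def[symmetric] x2_def[symmetric] x3_def[symmetric] x4_def[symmetric]
    by algebra
qed

lemma weight_recurrence_first:
  fixes r :: "'a::field_char_0"
  assumes "r \<notin> \<int>\<^sub>\<le>\<^sub>0"
  shows "(of_nat m + 1) * linearization_weight r 0 (Suc m) n * (of_nat (Suc (m + n)) + r) =
    (of_nat m + r) * (linearization_weight r 0 m n * (of_nat (m + n) + 2 * r))"
proof -
  have nz: "of_nat m + (1::'a) \<noteq> 0" by (metis of_nat_Suc of_nat_neq_0 add.commute)
  have nzs: "r + of_nat (m + n) + 1 \<noteq> 0"
    using add_of_nat_neq_0[OF assms, of "Suc (m + n)"] by (simp add: add_ac)
  have w: "linearization_weight r 0 (Suc m) n = linearization_weight r 0 m n *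
      (((r + of_nat m) / (of_nat m + 1)) * ((2 * r + of_nat (m + n)) / (r + of_nat (m + n) + 1)))"
    unfolding linearization_weight_def diff_zero add_Suc
      pochhammer_over_fact_Suc[of r m] pochhammer_quotient_Suc[of r "m + n"]
    by (simp only: mult_ac)
  show ?thesis
    unfolding w using nz nzs by (simp add: divide_simps) (simp add: algebra_simps)
qed

lemma weight_recurrence_last:
  fixes r :: "'a::field_char_0"
  assumes "m < n"
  shows "(of_nat m + 1) * linearization_weight r (Suc m) (Suc m) n * (of_nat (n - Suc m) + r) =
    (of_nat m + r) * (linearization_weight r m m n * of_nat (n - m))"
proof -
  obtain q where n: "n = Suc (q + m)"
    using assms by (metis add.commute less_imp_Suc_add)
  define d where "d = pochhammer (2 * r) n / pochhammer r (Suc n)"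
  have nz: "of_nat m + (1::'a) \<noteq> 0" "of_nat q + (1::'a) \<noteq> 0"
    by (metis of_nat_Suc of_nat_neq_0 add.commute)+
  have w1: "linearization_weight r (Suc m) (Suc m) n =
      (pochhammer r m / fact m) * ((r + of_nat m) / (of_nat m + 1)) * (pochhammer r q / fact q) * d"
    by (simp add: linearization_weight_def n d_def pochhammer_over_fact_Suc[of r m] del: fact_Suc)
  have w2: "linearization_weight r m m n =
      (pochhammer r m / fact m) *
      ((pochhammer r q / fact q) * ((r + of_nat q) / (of_nat q + 1))) * d"
    by (simp add: linearization_weight_def n d_def pochhammer_over_fact_Suc[of r q] Suc_diff_le
          del: fact_Suc)
  have N: "(of_nat (n - Suc m) :: 'a) = of_nat q" "(of_nat (n - m) :: 'a) = of_nat q + 1"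
    by (simp_all add: n)
  show ?thesis unfolding w1 w2 N
    using nz by (simp add: divide_simps add_ac)
qed

text \<open>
  Dougall's linearization formula for any solution \<open>g\<close> of the ultraspherical recurrence. Both sides
  are quadratic in \<open>g\<close>, so no normalization of \<open>g 0\<close> is required. At \<open>n = 0\<close> the value \<open>g (n - 1)\<close>
  is multiplied by \<open>0\<close>, so the truncation in \<open>n - 1\<close> is harmless.
\<close>

theorem ultraspherical_linearization:
  fixes g :: "nat \<Rightarrow> 'a::field_char_0"
  assumes r: "2 * r \<notin> \<int>\<^sub>\<le>\<^sub>0"
    and rec: "\<And>n. (of_nat n + 2 * r) * g (Suc n) = 2 * (of_nat n + r) * x * g n - of_nat n * g (n - 1)"
    and "m \<le> n"
  shows "(pochhammer (2 * r) m / fact m * g m) * (pochhammer (2 * r) n / fact n * g n) =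
    g 0 * (\<Sum>k\<le>m. linearization_weight r k m n * (of_nat (m + n - 2 * k) + r) * g (m + n - 2 * k))"
proof -
  define c where "c = (\<lambda>j. pochhammer (2 * r) j / fact j * g j)"
  define w where "w = linearization_weight r"
  note r' = half_notin_nonpos_Ints[OF r]
  have c_Suc: "(of_nat m + 1) * c (Suc m) =
      pochhammer (2 * r) m / fact m * (2 * (of_nat m + r) * x * g m - of_nat m * g (m - 1))" for m
  proof -
    have nz: "of_nat m + (1::'a) \<noteq> 0" by (metis of_nat_Suc of_nat_neq_0 add.commute)
    show ?thesis unfolding rec[symmetric] c_def pochhammer_over_fact_Suc
      using nz by (simp add: divide_simps add_ac)
  qed
  have c_rec_0: "c (Suc 0) = 2 * r * x * c 0"
    using c_Suc[of 0] by (simp add: c_def)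
  have c_rec: "(of_nat m + 1) * c (Suc m) =
      2 * (of_nat m + r) * x * c m - (of_nat m + 2 * r - 1) * c (m - 1)" if "0 < m" for m
  proof -
    from that obtain l where m: "m = Suc l" using gr0_implies_Suc by blast
    have nz: "of_nat l + (1::'a) \<noteq> 0" by (metis of_nat_Suc of_nat_neq_0 add.commute)
    have "pochhammer (2 * r) m / fact m * of_nat m = (of_nat m + 2 * r - 1) * (pochhammer (2 * r) l / fact l)"
      unfolding m pochhammer_over_fact_Suc using nz by (simp add: divide_simps add_ac)
    moreover define u v where "u = pochhammer (2 * r) m / fact m" and "v = pochhammer (2 * r) l / fact l"
    moreover have "c m = u * g m" "c (m - 1) = v * g (m - 1)" by (simp_all add: c_def u_def v_def m)
    ultimately show ?thesis unfolding c_Suc by algebra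
  qed
  \<comment> \<open>The recurrence read as multiplication by \<open>2x\<close> on the weighted terms.\<close>
  have xg: "2 * x * ((of_nat N + r) * g N) = (of_nat N + 2 * r) * g (Suc N) + of_nat N * g (N - 1)" for N
    unfolding rec by (simp add: algebra_simps)
  have "c m * c n = g 0 * (\<Sum>k\<le>m. w k m n * (of_nat (m + n - 2 * k) + r) * g (m + n - 2 * k))"
    using \<open>m \<le> n\<close>
  proof (induction m rule: less_induct)
    case (less M)
    show ?case
    proof (cases M)
      case 0
      have "pochhammer r n \<noteq> 0" "pochhammer (2 * r) n \<noteq> 0" "r + of_nat n \<noteq> 0"
        using r r' by (auto simp: pochhammer_eq_0_iff add_of_nat_neq_0)
      then have "w 0 0 n * (of_nat n + r) = pochhammer (2 * r) n / fact n"
        by (simp add: w_def linearization_weight_def pochhammer_Suc add.commute[of r])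
      then show ?thesis by (simp add: 0 c_def)
    next
      case (Suc m)
      have mn: "m < n" using less.prems Suc by simp
      \<comment> \<open>\<open>T\<close> collects the terms of the target sum, \<open>X\<close> and \<open>Y\<close> those of degree one higher and one
          lower that come from multiplication by \<open>2x\<close>, and \<open>Z\<close> those of the product for \<open>m - 1\<close>.
          \<open>G k\<close> has degree \<open>m + n + 1 - 2k\<close>, so that \<open>X (Suc k)\<close>, \<open>Y k\<close> and \<open>Z k\<close> share a degree.\<close>
      define G where "G = (\<lambda>k. g (m + n + 1 - 2 * k))"
      define T where "T = (\<lambda>k. (of_nat m + 1) * w k (Suc m) n * (of_nat (m + n + 1 - 2 * k) + r) * G k)"
      define X where "X = (\<lambda>k. (of_nat m + r) * (w k m n * (of_nat (m + n - 2 * k) + 2 * r)) * G k)"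
      define Y where "Y = (\<lambda>k. (of_nat m + r) * (w k m n * of_nat (m + n - 2 * k)) * G (Suc k))"
      define Z where "Z = (\<lambda>k. (of_nat m + 2 * r - 1) * w k (m - 1) n *
                              (of_nat (m + n - Suc (2 * k)) + r) * G (Suc k))"
      have "2 * (of_nat m + r) * x * c m * c n = (of_nat m + r) * (2 * x) * (c m * c n)"
        by (simp add: mult_ac)
      also have "\<dots> = g 0 * (\<Sum>k\<le>m. (of_nat m + r) * w k m n *
          (2 * x * ((of_nat (m + n - 2 * k) + r) * g (m + n - 2 * k))))"
      proof -
        have IH: "c m * c n = g 0 * (\<Sum>k\<le>m. w k m n * (of_nat (m + n - 2 * k) + r) * g (m + n - 2 * k))"
          using less.IH[of m] mn Suc by simp
        show ?thesis unfolding IH by (simp only: sum_distrib_left mult_ac)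
      qed
      also have "\<dots> = g 0 * (\<Sum>k\<le>m. X k + Y k)"
      proof -
        have "(of_nat m + r) * w k m n *
          (2 * x * ((of_nat (m + n - 2 * k) + r) * g (m + n - 2 * k))) = X k + Y k" if "k \<le> m" for k
        proof -
          have "Suc (m + n - 2 * k) = m + n + 1 - 2 * k" "m + n - 2 * k - 1 = m + n + 1 - 2 * Suc k"
            using that mn by simp_all
          then show ?thesis unfolding xg by (simp add: X_def Y_def G_def algebra_simps)
        qed
        then show ?thesis by simp
      qed
      finally have A: "2 * (of_nat m + r) * x * c m * c n = g 0 * (\<Sum>k\<le>m. X k + Y k)" .
      \<comment> \<open>For \<open>m = 0\<close> the sum of \<open>Z\<close> is empty, and the recurrence for \<open>c\<close> has no second term.\<close>
      have "(of_nat m + 1) * (c (Suc m) * c n) = g 0 * ((\<Sum>k\<le>m. X k + Y k) - (\<Sum>k<m. Z k))"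
      proof (cases "m = 0")
        case True
        then show ?thesis using A c_rec_0 by simp
      next
        case False
        then obtain l where l: "m = Suc l" by (cases m) auto
        have "(of_nat m + 2 * r - 1) * (c l * c n) = g 0 * (\<Sum>k<m. Z k)"
          using less.IH[of l] mn Suc
          by (simp add: l Z_def G_def lessThan_Suc_atMost sum_distrib_left mult_ac)
        moreover have "(of_nat m + 1) * (c (Suc m) * c n) =
            2 * (of_nat m + r) * x * c m * c n - (of_nat m + 2 * r - 1) * (c l * c n)"
          using c_rec[of m] unfolding l diff_Suc_1 mult.assoc[symmetric]
          by (simp add: left_diff_distrib)
        ultimately show ?thesis using A by (simp add: right_diff_distrib)
      qed
      also have "(\<Sum>k\<le>m. X k + Y k) - (\<Sum>k<m. Z k) = X 0 + (\<Sum>k<m. X (Suc k) + Y k - Z k) + Y m"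
      proof -
        have "(\<Sum>k\<le>m. X k) = X 0 + (\<Sum>k<m. X (Suc k))"
          by (simp add: sum.atMost_shift)
        moreover have "(\<Sum>k\<le>m. Y k) = (\<Sum>k<m. Y k) + Y m"
          by (simp add: lessThan_Suc_atMost[symmetric])
        ultimately show ?thesis by (simp add: sum.distrib sum_subtractf)
      qed
      also have "X 0 = T 0"
        using weight_recurrence_first[OF r', of m n] by (simp add: X_def T_def w_def)
      also have "(\<Sum>k<m. X (Suc k) + Y k - Z k) = (\<Sum>k<m. T (Suc k))"
      proof (rule sum.cong)
        fix k assume "k \<in> {..<m}"
        then have "k < m" by simp
        have idx: "m + n + 1 - 2 * Suc k = m + n - Suc (2 * k)" by simp
        from weight_recurrence_interior[OF r' \<open>k < m\<close> mn]
        show "X (Suc k) + Y k - Z k = T (Suc k)"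
          unfolding X_def Y_def Z_def T_def w_def idx by algebra
      qed simp
      also have "Y m = T (Suc m)"
        using weight_recurrence_last[OF mn, of r] mn by (simp add: Y_def T_def w_def)
      also have "T 0 + (\<Sum>k<m. T (Suc k)) + T (Suc m) = (\<Sum>k\<le>Suc m. T k)"
        by (simp add: sum.atMost_shift)
      also have "\<dots> = (of_nat m + 1) *
          (\<Sum>k\<le>M. w k M n * (of_nat (M + n - 2 * k) + r) * g (M + n - 2 * k))"
        by (simp add: T_def G_def Suc sum_distrib_left mult_ac del: sum.atMost_Suc)
      finally have *: "(of_nat m + 1) * (c M * c n) = (of_nat m + 1) *
          (g 0 * (\<Sum>k\<le>M. w k M n * (of_nat (M + n - 2 * k) + r) * g (M + n - 2 * k)))"
        by (simp add: Suc mult_ac)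
      have "of_nat m + (1::'a) \<noteq> 0" by (metis of_nat_Suc of_nat_neq_0 add.commute)
      with * show ?thesis by simp
    qed
  qed
  then show ?thesis by (simp add: c_def w_def)
qed

section \<open>The recurrence for the Ferrers functions\<close>

text \<open>
  The coefficient of \<open>((1 - x)/2)\<^sup>j\<close> in the series for the Ferrers function of degree \<open>nu\<close> and order
  \<open>- mu\<close>, without the power prefactor.
\<close>

definition ferrers_coeff :: "complex \<Rightarrow> complex \<Rightarrow> nat \<Rightarrow> complex" where
  "ferrers_coeff mu nu j =
     pochhammer (- nu) j * pochhammer (nu + 1) j * rGamma (mu + 1 + of_nat j) / fact j"

lemma ferrers_coeff_recurrence_0:
  "(nu + mu + 1) * ferrers_coeff mu (nu + 1) 0 =
     (2 * nu + 1) * ferrers_coeff mu nu 0 - (nu - mu) * ferrers_coeff mu (nu - 1) 0"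
  by (simp add: ferrers_coeff_def algebra_simps)

text \<open>
  The contiguous relation in the degree. Each of the four products is a multiple of
  \<open>(-nu)\<^sub>J (nu + 1)\<^sub>J / \<Gamma>(mu + 2 + J)\<close>, and the relation reduces to a polynomial identity in
  \<open>nu\<close>, \<open>mu\<close> and \<open>J\<close>.
\<close>

lemma ferrers_coeff_recurrence:
  "(nu + mu + 1) * ferrers_coeff mu (nu + 1) (Suc J) =
     (2 * nu + 1) * (ferrers_coeff mu nu (Suc J) - 2 * ferrers_coeff mu nu J)
     - (nu - mu) * ferrers_coeff mu (nu - 1) (Suc J)"
proof -
  define j where "j = (of_nat J :: complex)"
  define U where "U = pochhammer (- nu) J"
  define V where "V = pochhammer (nu + 1) J"
  have U: "U * (j - nu) = - nu * pochhammer (1 - nu) J"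
    using pochhammer_Suc[of "- nu" J] pochhammer_rec[of "- nu" J] by (simp add: U_def j_def)
  have V: "V * (nu + 1 + j) = (nu + 1) * pochhammer (nu + 2) J"
    using pochhammer_Suc[of "nu + 1" J] pochhammer_rec[of "nu + 1" J]
    by (simp add: V_def j_def add_ac)
  define R where "R = rGamma (mu + 2 + j) / fact (Suc J)"
  have R: "rGamma (mu + 1 + of_nat J) / fact J = (mu + 1 + j) * (j + 1) * R"
  proof -
    have "rGamma (mu + 1 + j) = (mu + 1 + j) * rGamma (mu + 2 + j)"
      using rGamma_plus1[of "mu + 1 + j"] by (simp add: add_ac)
    moreover have "j + 1 \<noteq> 0" unfolding j_def by (metis of_nat_Suc of_nat_neq_0 add.commute)
    moreover have "fact (Suc J) = (j + 1) * fact J" by (simp add: j_def add.commute)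
    ultimately show ?thesis unfolding R_def by (simp add: j_def[symmetric] del: fact_Suc)
  qed
  have RS: "rGamma (mu + 1 + of_nat (Suc J)) / fact (Suc J) = R"
    by (simp add: R_def j_def add_ac)
  have "pochhammer (- (nu + 1)) (Suc J) * pochhammer (nu + 1 + 1) (Suc J) =
        - ((nu + 1) * pochhammer (nu + 2) J) * U * (nu + 2 + j)"
  proof -
    have "pochhammer (- (nu + 1)) (Suc J) = - (nu + 1) * U"
      unfolding pochhammer_rec U_def by simp
    moreover have "pochhammer (nu + 1 + 1) (Suc J) = pochhammer (nu + 2) J * (nu + 2 + j)"
      unfolding pochhammer_Suc j_def by (simp add: add.assoc)
    ultimately show ?thesis by algebra
  qed
  then have c1: "ferrers_coeff mu (nu + 1) (Suc J) = - U * V * (nu + 1 + j) * (nu + 2 + j) * R"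
    unfolding ferrers_coeff_def times_divide_eq_right[symmetric] RS V[symmetric] by simp
  have c2: "ferrers_coeff mu nu (Suc J) = U * V * (j - nu) * (nu + 1 + j) * R"
    unfolding ferrers_coeff_def times_divide_eq_right[symmetric] RS
    by (simp add: pochhammer_Suc U_def V_def j_def)
  have c3: "ferrers_coeff mu nu J = U * V * (mu + 1 + j) * (j + 1) * R"
    unfolding ferrers_coeff_def times_divide_eq_right[symmetric] R
    by (simp add: U_def V_def)
  have "pochhammer (- (nu - 1)) (Suc J) * pochhammer (nu - 1 + 1) (Suc J) =
        - (- nu * pochhammer (1 - nu) J) * V * (j - nu + 1)"
  proof -
    have "pochhammer (- (nu - 1)) (Suc J) = pochhammer (1 - nu) J * (j - nu + 1)"
      unfolding pochhammer_Suc j_def by (simp add: algebra_simps)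
    moreover have "pochhammer (nu - 1 + 1) (Suc J) = nu * V"
      unfolding pochhammer_rec V_def by simp
    ultimately show ?thesis by algebra
  qed
  then have c4: "ferrers_coeff mu (nu - 1) (Suc J) = - U * V * (j - nu) * (j - nu + 1) * R"
    unfolding ferrers_coeff_def times_divide_eq_right[symmetric] RS U[symmetric] by simp
  show ?thesis unfolding c1 c2 c3 c4 by algebra
qed

lemma Ferrers_P_eq_ferrers_coeff:
  "Ferrers_P nu (- mu) x = complex_of_real ((1 - x) / (1 + x)) powr (mu / 2) *
     (\<Sum>j. ferrers_coeff mu nu j * complex_of_real ((1 - x) / 2) ^ j)"
  by (simp add: Ferrers_P_def ferrers_coeff_def add.commute[of 1 mu])

text \<open>
  The second hypothesis keeps the factor \<open>nu - mu\<close> inside the series. It is then trivially met for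
  \<open>nu = mu\<close>, which starts the induction on the degree without a preceding series.
\<close>

lemma ferrers_series_sums_Suc:
  fixes z :: complex
  assumes "(\<lambda>j. ferrers_coeff mu nu j * z ^ j) sums S"
    and "(\<lambda>j. (nu - mu) * ferrers_coeff mu (nu - 1) j * z ^ j) sums S'"
    and "nu + mu + 1 \<noteq> 0"
  shows "(\<lambda>j. ferrers_coeff mu (nu + 1) j * z ^ j) sums
    (((2 * nu + 1) * (1 - 2 * z) * S - S') / (nu + mu + 1))"
proof -
  \<comment> \<open>\<open>sh\<close> is the series multiplied by \<open>z\<close>, reindexed by powers of \<open>z\<close>.\<close>
  define sh where "sh = (\<lambda>j. case j of 0 \<Rightarrow> 0 | Suc i \<Rightarrow> ferrers_coeff mu nu i * z ^ i * z)"
  have "(\<lambda>i. sh (Suc i)) sums (S * z)"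
    using sums_mult2[OF assms(1), of z] by (simp add: sh_def)
  then have sh: "sh sums (S * z)"
    by (subst (asm) sums_Suc_iff) (simp add: sh_def)
  have "(\<lambda>j. ((2 * nu + 1) * (ferrers_coeff mu nu j * z ^ j - 2 * sh j)
        - (nu - mu) * ferrers_coeff mu (nu - 1) j * z ^ j) / (nu + mu + 1)) sums
     (((2 * nu + 1) * (S - 2 * (S * z)) - S') / (nu + mu + 1))"
    by (intro sums_divide sums_diff sums_mult assms(1,2) sh)
  moreover have "((2 * nu + 1) * (ferrers_coeff mu nu j * z ^ j - 2 * sh j)
        - (nu - mu) * ferrers_coeff mu (nu - 1) j * z ^ j) / (nu + mu + 1) =
      ferrers_coeff mu (nu + 1) j * z ^ j" for j
  proof -
    have "(2 * nu + 1) * (ferrers_coeff mu nu j * z ^ j - 2 * sh j)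
        - (nu - mu) * ferrers_coeff mu (nu - 1) j * z ^ j =
        (nu + mu + 1) * ferrers_coeff mu (nu + 1) j * z ^ j"
    proof (cases j)
      case 0
      then show ?thesis using ferrers_coeff_recurrence_0[of nu mu] by (simp add: sh_def)
    next
      case (Suc i)
      show ?thesis unfolding Suc ferrers_coeff_recurrence
        by (simp add: sh_def algebra_simps)
    qed
    then show ?thesis using assms(3) by simp
  qed
  ultimately show ?thesis by (simp add: algebra_simps)
qed

text \<open>
  For degree \<open>nu = mu\<close>, the factor \<open>(mu + 1)\<^sub>j\<close> cancels against the reciprocal Gamma function and a
  binomial series is left.
\<close>

lemma ferrers_series_sums_0:
  fixes z :: complex
  assumes "norm z < 1"
  shows "(\<lambda>j. ferrers_coeff mu mu j * z ^ j) sums (rGamma (mu + 1) * (1 - z) powr mu)"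
proof -
  have "ferrers_coeff mu mu j * z ^ j = rGamma (mu + 1) * ((mu gchoose j) * (- z) ^ j)" for j
    unfolding ferrers_coeff_def pochhammer_rGamma[of "mu + 1" j] gbinomial_pochhammer
    by (simp add: power_minus[of z] mult_ac)
  then show ?thesis
    using sums_mult[OF gen_binomial_complex[of "- z" mu], of "rGamma (mu + 1)"] assms by simp
qed

lemma ferrers_series_summable:
  fixes z :: complex
  assumes "norm z < 1" and "2 * mu + 1 \<notin> \<int>\<^sub>\<le>\<^sub>0"
  shows "summable (\<lambda>j. ferrers_coeff mu (of_nat n + mu) j * z ^ j)"
proof (induction n rule: less_induct)
  case (less N)
  show ?case
  proof (cases N)
    case 0
    then show ?thesis using ferrers_series_sums_0[OF assms(1)] by (auto simp: sums_iff)
  next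
    case (Suc n)
    have nz: "of_nat n + mu + mu + 1 \<noteq> 0"
      using add_of_nat_neq_0[OF assms(2), of n] by (simp add: algebra_simps)
    have *: "summable (\<lambda>j. (of_nat n + mu - mu) * ferrers_coeff mu (of_nat n + mu - 1) j * z ^ j)"
    proof (cases n)
      case 0
      then show ?thesis by simp
    next
      case (Suc l)
      then show ?thesis
        using less.IH[of l] \<open>N = Suc n\<close> by (auto simp: mult.assoc add_ac intro!: summable_mult)
    qed
    have N: "of_nat N + mu = of_nat n + mu + 1" by (simp add: Suc)
    have "summable (\<lambda>j. ferrers_coeff mu (of_nat n + mu) j * z ^ j)"
      using less.IH[of n] Suc by simp
    then show ?thesis unfolding N
      by (rule sums_summable[OF ferrers_series_sums_Suc[OF summable_sums summable_sums[OF *] nz]])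
  qed
qed

lemma Ferrers_P_recurrence:
  assumes x: "-1 < x" "x < 1" and mu: "2 * mu + 1 \<notin> \<int>\<^sub>\<le>\<^sub>0"
  defines "p \<equiv> \<lambda>n. Ferrers_P (of_nat n + mu) (- mu) x"
  shows "(of_nat n + 2 * (mu + 1 / 2)) * p (Suc n) =
    2 * (of_nat n + (mu + 1 / 2)) * complex_of_real x * p n - of_nat n * p (n - 1)"
proof -
  define z where "z = complex_of_real ((1 - x) / 2)"
  define K where "K = complex_of_real ((1 - x) / (1 + x)) powr (mu / 2)"
  define F where "F = (\<lambda>n. \<Sum>j. ferrers_coeff mu (of_nat n + mu) j * z ^ j)"
  have z: "norm z < 1" using x unfolding z_def norm_of_real by simp
  have p: "p n = K * F n" for n
    unfolding p_def Ferrers_P_eq_ferrers_coeff K_def F_def z_def ..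
  have F: "(\<lambda>j. ferrers_coeff mu (of_nat n + mu) j * z ^ j) sums F n" for n
    unfolding F_def by (rule summable_sums[OF ferrers_series_summable[OF z mu]])
  have nz: "of_nat n + mu + mu + 1 \<noteq> 0"
    using add_of_nat_neq_0[OF mu, of n] by (simp add: algebra_simps)
  have F': "(\<lambda>j. (of_nat n + mu - mu) * ferrers_coeff mu (of_nat n + mu - 1) j * z ^ j) sums
     (of_nat n * F (n - 1))"
  proof (cases n)
    case (Suc l)
    then show ?thesis using sums_mult[OF F[of l], of "of_nat n"] by (simp add: mult.assoc add_ac)
  qed simp
  have N: "of_nat (Suc n) + mu = of_nat n + mu + 1" by simp
  have "F (Suc n) = ((2 * (of_nat n + mu) + 1) * (1 - 2 * z) * F n - of_nat n * F (n - 1)) /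
     (of_nat n + mu + mu + 1)"
    using sums_unique2[OF F[of "Suc n", unfolded N] ferrers_series_sums_Suc[OF F F' nz]] .
  moreover have "1 - 2 * z = complex_of_real x" by (simp add: z_def diff_divide_distrib)
  ultimately have "(of_nat n + mu + mu + 1) * F (Suc n) =
      (2 * (of_nat n + mu) + 1) * complex_of_real x * F n - of_nat n * F (n - 1)"
    using nz by simp
  then have "K * ((of_nat n + mu + mu + 1) * F (Suc n)) =
      K * ((2 * (of_nat n + mu) + 1) * complex_of_real x * F n - of_nat n * F (n - 1))"
    by simp
  then show ?thesis unfolding p by (simp add: algebra_simps)
qed

lemma Ferrers_P_neg_self:
  assumes "-1 < x" "x < 1"
  shows "Ferrers_P mu (- mu) x =
    complex_of_real (1 - x\<^sup>2) powr (mu / 2) * rGamma (mu + 1) / 2 powr mu"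
proof -
  define z where "z = complex_of_real ((1 - x) / 2)"
  have z: "norm z < 1" using assms unfolding z_def norm_of_real by simp
  have "1 - z = complex_of_real ((1 + x) / 2)" by (simp add: z_def field_simps)
  then have P: "Ferrers_P mu (- mu) x = complex_of_real ((1 - x) / (1 + x)) powr (mu / 2) *
     (rGamma (mu + 1) * complex_of_real ((1 + x) / 2) powr mu)"
    unfolding Ferrers_P_eq_ferrers_coeff z_def[symmetric]
    using sums_unique[OF ferrers_series_sums_0[OF z, of mu]] by (simp only:)
  have pw: "complex_of_real y powr w = exp (w * complex_of_real (ln y))" if "y > 0" for y w
    using that by (simp add: powr_def Ln_of_real)
  have ln: "ln ((1 - x) / (1 + x)) = ln (1 - x) - ln (1 + x)"
    "ln ((1 + x) / 2) = ln (1 + x) - ln 2" "ln (1 - x\<^sup>2) = ln (1 - x) + ln (1 + x)"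
    using assms ln_mult[of "1 - x" "1 + x"] 
    by (simp_all add: ln_div power2_eq_square algebra_simps)
  have pos: "(1 - x) / (1 + x) > 0" "(1 + x) / 2 > 0" "1 - x\<^sup>2 > 0"
    using assms by (auto simp: abs_square_less_1)
  have two: "2 powr mu = exp (mu * complex_of_real (ln 2))" using pw[of 2] by simp
  have "complex_of_real ((1 - x) / (1 + x)) powr (mu / 2) * complex_of_real ((1 + x) / 2) powr mu
      = complex_of_real (1 - x\<^sup>2) powr (mu / 2) / 2 powr mu"
    unfolding pw[OF pos(1)] pw[OF pos(2)] pw[OF pos(3)] two ln exp_add[symmetric] exp_diff[symmetric]
    by (rule arg_cong[of _ _ exp]) (simp add: field_simps)
  then show ?thesis unfolding P by (simp add: mult_ac)
qed

section \<open>The product formula\<close>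

lemma Gamma_normalization:
  assumes "2 * mu + 1 \<notin> \<int>\<^sub>\<le>\<^sub>0"
  shows "rGamma (mu + 1) / 2 powr mu =
    2 powr mu * Gamma (mu + 1 / 2) / (complex_of_real (sqrt pi) * Gamma (2 * mu + 1))"
proof -
  have r: "2 * (mu + 1 / 2) \<notin> \<int>\<^sub>\<le>\<^sub>0" using assms by (simp add: algebra_simps)
  note r' = half_notin_nonpos_Ints[OF r]
  have mu1: "mu + 1 \<notin> \<int>\<^sub>\<le>\<^sub>0"
  proof
    assume "mu + 1 \<in> \<int>\<^sub>\<le>\<^sub>0"
    then obtain j where "mu + 1 = - of_nat j" by (rule nonpos_Ints_cases')
    then have "mu = - of_nat j - 1" by (simp add: algebra_simps)
    then have "2 * mu + 1 = - of_nat (2 * j + 1)" by simp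
    then show False using assms by (metis minus_of_nat_in_nonpos_Ints)
  qed
  have arg: "2 * (mu + 1 / 2) = 2 * mu + 1" "mu + 1 / 2 + 1 / 2 = mu + 1"
    by (simp_all add: algebra_simps)
  define e where "e = exp ((1 - (2 * mu + 1)) * of_real (ln 2))"
  have "Gamma (mu + 1 / 2) * Gamma (mu + 1 / 2 + 1 / 2) =
      exp ((1 - 2 * (mu + 1 / 2)) * of_real (ln 2)) * of_real (sqrt pi) * Gamma (2 * (mu + 1 / 2))"
    by (rule Gamma_legendre_duplication) (use r' mu1 in \<open>simp_all only: arg not_False_eq_True\<close>)
  then have dup: "Gamma (mu + 1 / 2) * Gamma (mu + 1) = e * of_real (sqrt pi) * Gamma (2 * mu + 1)"
    unfolding arg e_def .
  have e: "e * (2 powr mu * 2 powr mu) = 1"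
  proof -
    have two: "2 powr mu = exp (mu * complex_of_real (ln 2))"
      by (simp add: powr_def Ln_of_real[of 2, simplified])
    show ?thesis unfolding two e_def exp_add[symmetric] by (simp add: algebra_simps)
  qed
  have "Gamma (mu + 1) \<noteq> 0" "Gamma (2 * mu + 1) \<noteq> 0"
    using assms mu1 by (simp_all add: Gamma_eq_zero_iff)
  moreover have "2 powr mu * Gamma (mu + 1 / 2) * (Gamma (mu + 1) * 2 powr mu) =
      complex_of_real (sqrt pi) * Gamma (2 * mu + 1)"
    using dup e by algebra
  ultimately show ?thesis
    unfolding rGamma_inverse_Gamma inverse_eq_divide divide_divide_eq_left
    by (subst frac_eq_eq) simp_all
qed

text \<open>No side condition on \<open>r\<close> is needed: where a denominator vanishes, both sides are \<open>0\<close>.\<close>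

lemma gegenbauer_lin_coeff_eq_weight:
  assumes "k \<le> m" "m \<le> n"
  shows "gegenbauer_lin_coeff r k m n = linearization_weight r k m n *
     (of_nat (m + n - 2 * k) + r) * (fact (m + n - 2 * k) / pochhammer (2 * r) (m + n - 2 * k))"
proof -
  have "of_nat m + of_nat n + r - 2 * of_nat k = of_nat (m + n - 2 * k) + r"
    using assms by (simp add: of_nat_diff algebra_simps)
  moreover have "pochhammer r (Suc (m + n - k)) =
      pochhammer r (m + n - k) * (of_nat m + of_nat n + r - of_nat k)"
    using assms by (simp add: pochhammer_Suc of_nat_diff algebra_simps)
  ultimately show ?thesis
    unfolding gegenbauer_lin_coeff_def linearization_weight_def
    by (simp add: mult_ac)
qed

theorem corollary3p2:
  fixes n m :: nat and lam :: complex and x :: real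
  assumes "n \<ge> m"
    and "2 * lam + 1 \<notin> \<int>\<^sub>\<le>\<^sub>0"
    and "-1 < x" and "x < 1"
  shows "Ferrers_P (of_nat n + lam) (- lam) x * Ferrers_P (of_nat m + lam) (- lam) x =
    (2 powr lam * Gamma (lam + 1 / 2) * fact m * fact n *
      complex_of_real (1 - x\<^sup>2) powr (lam / 2)) /
    (complex_of_real (sqrt pi) * Gamma (2 * lam + of_nat m + 1) * Gamma (2 * lam + of_nat n + 1)) *
    (\<Sum>k = 0..m. gegenbauer_lin_coeff (lam + 1 / 2) k m n *
      (Gamma (2 * lam + of_nat (n + m - 2 * k) + 1) / fact (n + m - 2 * k)) *
      Ferrers_P (of_nat (n + m - 2 * k) + lam) (- lam) x)"
proof -
  define r where "r = lam + 1 / 2"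
  define p where "p = (\<lambda>n. Ferrers_P (of_nat n + lam) (- lam) x)"
  have r2: "2 * r = 2 * lam + 1" by (simp add: r_def)
  have r: "2 * r \<notin> \<int>\<^sub>\<le>\<^sub>0" using assms(2) by (simp add: r2)
  have poch_nz: "pochhammer (2 * r) j \<noteq> 0" for j
    using r by (auto simp: pochhammer_eq_0_iff)
  have Gamma_nz: "Gamma (2 * r) \<noteq> 0" using r by (simp add: Gamma_eq_zero_iff)
  have Gamma_shift: "Gamma (2 * lam + of_nat j + 1) = pochhammer (2 * r) j * Gamma (2 * r)" for j
    using pochhammer_Gamma[OF r, of j] Gamma_nz by (simp add: r2 add_ac)
  define S where "S = (\<Sum>k\<le>m. linearization_weight r k m n *
      (of_nat (m + n - 2 * k) + r) * p (m + n - 2 * k))"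
  have "(pochhammer (2 * r) m / fact m * p m) * (pochhammer (2 * r) n / fact n * p n) = p 0 * S"
    unfolding S_def
  proof (rule ultraspherical_linearization[OF r _ assms(1), where x = "complex_of_real x"])
    show "(of_nat j + 2 * r) * p (Suc j) =
        2 * (of_nat j + r) * complex_of_real x * p j - of_nat j * p (j - 1)" for j
      using Ferrers_P_recurrence[OF assms(3,4,2), of j] unfolding p_def r_def .
  qed
  then have prod: "p n * p m =
      fact m * fact n / (pochhammer (2 * r) m * pochhammer (2 * r) n) * p 0 * S"
    using poch_nz by (simp add: field_simps)
  have sum: "(\<Sum>k = 0..m. gegenbauer_lin_coeff r k m n *
      (Gamma (2 * lam + of_nat (n + m - 2 * k) + 1) / fact (n + m - 2 * k)) *
      p (n + m - 2 * k)) = Gamma (2 * r) * S"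
    unfolding S_def sum_distrib_left atLeast0AtMost
  proof (rule sum.cong)
    fix k assume "k \<in> {..m}"
    then have "k \<le> m" by simp
    show "gegenbauer_lin_coeff r k m n *
      (Gamma (2 * lam + of_nat (n + m - 2 * k) + 1) / fact (n + m - 2 * k)) * p (n + m - 2 * k) =
      Gamma (2 * r) * (linearization_weight r k m n * (of_nat (m + n - 2 * k) + r) * p (m + n - 2 * k))"
      unfolding Gamma_shift gegenbauer_lin_coeff_eq_weight[OF \<open>k \<le> m\<close> assms(1)] add.commute[of n m]
      using poch_nz by simp
  qed simp
  have p0: "p 0 = complex_of_real (1 - x\<^sup>2) powr (lam / 2) *
      (2 powr lam * Gamma r / (complex_of_real (sqrt pi) * Gamma (2 * r)))"
    unfolding r2 unfolding r_def Gamma_normalization[OF assms(2), symmetric]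
    using Ferrers_P_neg_self[OF assms(3,4), of lam] by (simp add: p_def)
  have p: "Ferrers_P (of_nat j + lam) (- lam) x = p j" for j
    by (simp add: p_def)
  show ?thesis
    unfolding p r_def[symmetric] sum
    unfolding prod p0 Gamma_shift
    using Gamma_nz by (simp add: mult_ac)
qed

end
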